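(* Let $G$ be a connected graph, let $X\subseteq V(G)$ be a twin cover of $G$, and let $Y\subseteq X$ be such that every shortest path in $G$ of length at least $3$ contains a vertex of $Y$. Then $\operatorname{svcfc}(G)\le \chi(G)+|Y|$.
   Context: All graphs are finite, simple and undirected; the length of a path is its number of edges. For a vertex coloring $c\colon V(G)\to\mathbb{N}$, a path is conflict-free if some color appears on exactly one of its vertices. A coloring of a connected graph $G$ is a strong CFVC coloring if every two distinct vertices $u,v$ are joined by a conflict-free shortest $u$-$v$ path. $\operatorname{svcfc}(G)$ is the minimum number of colors of a strong CFVC coloring of $G$; $\chi(G)$ is the chromatic number. Vertices $u\neq v$ are true twins if $N_G[u]=N_G[v]$; a twin edge is an edge whose endpoints are true twins; $X\subseteq V(G)$ is a twin cover if every edge of $G-X$ is a twin edge. *)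

theory Defs
  imports "Graph_Theory.Graph_Theory"
begin

text \<open>
  Finite simple undirected graphs are taken to be the digraphs satisfying the locale predicate
  \<^const>\<open>graph\<close> (finite, symmetric, without loops and parallel arcs): an undirected edge \<open>uv\<close> is the
  pair of arcs \<open>u \<rightarrow> v\<close> and \<open>v \<rightarrow> u\<close>. Paths are the vertex lists of \<^const>\<open>vpath\<close>, and
  \<^const>\<open>vwalk_length\<close> counts their edges. The library's connectedness requires a vertex.
\<close>

definition shortest_vpath :: "('a, 'b) pre_digraph \<Rightarrow> 'a \<Rightarrow> 'a list \<Rightarrow> 'a \<Rightarrow> bool" where
  "shortest_vpath G u p v \<longleftrightarrow>
     vpath p G \<and> hd p = u \<and> last p = v \<and>
     (\<forall>q. vpath q G \<and> hd q = u \<and> last q = v \<longrightarrow> vwalk_length p \<le> vwalk_length q)"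

definition conflict_free :: "('a \<Rightarrow> nat) \<Rightarrow> 'a list \<Rightarrow> bool" where
  "conflict_free c p \<longleftrightarrow> (\<exists>k. \<exists>!x. x \<in> set p \<and> c x = k)"

definition strong_cfvc_coloring :: "('a, 'b) pre_digraph \<Rightarrow> ('a \<Rightarrow> nat) \<Rightarrow> bool" where
  "strong_cfvc_coloring G c \<longleftrightarrow>
     (\<forall>u \<in> verts G. \<forall>v \<in> verts G. u \<noteq> v \<longrightarrow>
       (\<exists>p. shortest_vpath G u p v \<and> conflict_free c p))"

definition proper_coloring :: "('a, 'b) pre_digraph \<Rightarrow> ('a \<Rightarrow> nat) \<Rightarrow> bool" where
  "proper_coloring G c \<longleftrightarrow> (\<forall>u v. u \<rightarrow>\<^bsub>G\<^esub> v \<longrightarrow> c u \<noteq> c v)"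

definition chromatic_number :: "('a, 'b) pre_digraph \<Rightarrow> nat" where
  "chromatic_number G = (LEAST k. \<exists>c. proper_coloring G c \<and> card (c ` verts G) = k)"

text \<open>Meaningful for connected graphs only: otherwise no strong CFVC coloring exists.\<close>

definition svcfc :: "('a, 'b) pre_digraph \<Rightarrow> nat" where
  "svcfc G = (LEAST k. \<exists>c. strong_cfvc_coloring G c \<and> card (c ` verts G) = k)"

definition closed_nbhd :: "('a, 'b) pre_digraph \<Rightarrow> 'a \<Rightarrow> 'a set" where
  "closed_nbhd G v = insert v {w. v \<rightarrow>\<^bsub>G\<^esub> w}"

definition true_twins :: "('a, 'b) pre_digraph \<Rightarrow> 'a \<Rightarrow> 'a \<Rightarrow> bool" where
  "true_twins G u v \<longleftrightarrow>
     u \<in> verts G \<and> v \<in> verts G \<and> u \<noteq> v \<and> closed_nbhd G u = closed_nbhd G v"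

text \<open>Being twins refers to neighborhoods in \<open>G\<close>, not in \<open>G - X\<close>.\<close>

definition twin_cover :: "('a, 'b) pre_digraph \<Rightarrow> 'a set \<Rightarrow> bool" where
  "twin_cover G X \<longleftrightarrow>
     X \<subseteq> verts G \<and> (\<forall>u v. u \<rightarrow>\<^bsub>G \<restriction> (verts G - X)\<^esub> v \<longrightarrow> true_twins G u v)"

end

theory Submission
  imports Defs
begin

text \<open>
  Take an optimal proper coloring and give the vertices of \<open>Y\<close> pairwise distinct fresh colors; the
  result is still proper. On a path of length 1 or 2 in a properly colored graph the color of the
  second vertex is unique, and a longer shortest path meets \<open>Y\<close>, whose colors are unique in the
  whole graph.
\<close>

lemma (in graph) ex_shortest_vpath:
  assumes "Digraph_Component.connected G" "u \<in> verts G" "v \<in> verts G"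
  shows "\<exists>p. shortest_vpath G u p v"
proof -
  \<comment> \<open>Library connectedness refers to the symmetric closure; since the arcs of
    \<open>G\<close> are already symmetric, it yields directed reachability.\<close>
  have "u \<rightarrow>\<^sup>*\<^bsub>G\<^esub> v"
    using symmetric_connected_imp_strongly_connected[OF sym_arcs assms(1)] assms(2,3)
    by (simp add: strongly_connected_def)
  then obtain p where "vpath p G \<and> hd p = u \<and> last p = v"
    by (auto simp: reachable_vpath_conv)
  from ex_has_least_nat[of "\<lambda>p. vpath p G \<and> hd p = u \<and> last p = v", OF this, of vwalk_length]
  show ?thesis
    by (auto simp: shortest_vpath_def)
qed

text \<open>An injective numbering of the vertices is proper, as there are no loops. Such a witness
  guarantees that the \<open>LEAST\<close> in \<open>chromatic_number\<close> is attained.\<close>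

lemma (in graph) ex_proper_coloring: "\<exists>c. proper_coloring G c"
proof -
  obtain c :: "'a \<Rightarrow> nat" where "inj_on c (verts G)"
    using finite_imp_inj_to_nat_seg[OF finite_verts] by blast
  then show ?thesis
    by (metis adj_in_verts adj_not_same inj_on_eq_iff proper_coloring_def)
qed

lemma (in graph) chromatic_number_attained:
  obtains c where "proper_coloring G c" "card (c ` verts G) = chromatic_number G"
proof -
  have "\<exists>k c. proper_coloring G c \<and> card (c ` verts G) = k"
    using ex_proper_coloring by simp
  from LeastI_ex[OF this] show ?thesis
    unfolding chromatic_number_def[symmetric] using that by blast
qed

lemma conflict_freeI:
  assumes "x \<in> set p" "\<And>y. y \<in> set p \<Longrightarrow> c y = c x \<Longrightarrow> y = x"
  shows "conflict_free c p"
  unfolding conflict_free_def using assms by blast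

text \<open>Distinct ends force a second vertex \<open>y\<close>. It is adjacent to every other
  vertex of so short a walk, so its color differs from all others. The witness cannot in general be
  an end: in \<open>[x, y, z]\<close> the colors of \<open>x\<close> and \<open>z\<close> may
  agree.\<close>

lemma conflict_free_short_vwalk:
  assumes c: "proper_coloring G c" and p: "vwalk p G" "vwalk_length p < 3" "hd p \<noteq> last p"
  shows "conflict_free c p"
proof -
  have neq: "c a \<noteq> c b" if "a \<rightarrow>\<^bsub>G\<^esub> b" for a b
    using c that by (auto simp: proper_coloring_def)
  have "p \<noteq> []"
    using p(1) by auto
  with p(3) obtain x y q where q: "p = x # y # q"
    by (metis hd_Cons_tl last_ConsL list.sel(1))
  have xy: "x \<rightarrow>\<^bsub>G\<^esub> y"
    using p(1) q by (auto simp: vwalk_def)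
  show ?thesis
  proof (cases q)
    case Nil
    then show ?thesis
      using neq[OF xy] q by (intro conflict_freeI[of y]) auto
  next
    case (Cons z r)
    then have "r = []"
      using p(2) q by simp
    moreover have "y \<rightarrow>\<^bsub>G\<^esub> z"
      using p(1) q Cons by (auto simp: vwalk_def)
    ultimately show ?thesis
      using neq[OF xy] neq[of y z] q Cons by (intro conflict_freeI[of y]) auto
  qed
qed

lemma (in graph) fresh_recoloring:
  assumes c: "proper_coloring G c" and Y: "Y \<subseteq> verts G"
  obtains c' where "proper_coloring G c'" "card (c' ` verts G) \<le> card (c ` verts G) + card Y"
    "\<And>x y. y \<in> Y \<Longrightarrow> c' x = c' y \<Longrightarrow> x = y"
proof -
  have fin: "finite Y"
    using Y finite_verts by (rule finite_subset)
  then obtain e :: "'a \<Rightarrow> nat" where e: "inj_on e Y"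
    using finite_imp_inj_to_nat_seg by blast
  \<comment> \<open>Parity makes the new colors fresh: odd values occur only on \<open>Y\<close>,
    where \<open>e\<close> separates them, and even values encode the old colors.\<close>
  define c' where "c' v = (if v \<in> Y then Suc (2 * e v) else 2 * c v)" for v
  \<comment> \<open>If \<open>y\<close> is in \<open>Y\<close>, then \<open>c' y\<close> is odd, so
    \<open>x\<close> lies in \<open>Y\<close> too and injectivity of \<open>e\<close>
    applies.\<close>
  have unique: "x = y" if "y \<in> Y" "c' x = c' y" for x y
    using that e unfolding c'_def
    by (auto split: if_splits dest: inj_onD) presburger+
  have "proper_coloring G c'"
    unfolding proper_coloring_def
  proof (intro allI impI)
    fix u v assume uv: "u \<rightarrow>\<^bsub>G\<^esub> v"
    then have "u \<noteq> v" "c u \<noteq> c v"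
      using c adj_not_same by (auto simp: proper_coloring_def)
    \<comment> \<open>If an end lies in \<open>Y\<close>, equal colors would give
      \<open>u = v\<close> by \<open>unique\<close>; otherwise both ends carry their doubled old
      colors.\<close>
    then show "c' u \<noteq> c' v"
      using unique[of u v] unique[of v u] by (cases "u \<in> Y \<or> v \<in> Y") (auto simp: c'_def)
  qed
  moreover have "card (c' ` verts G) \<le> card (c ` verts G) + card Y"
  proof -
    \<comment> \<open>Only an inclusion: an old color worn solely by vertices of \<open>Y\<close>
      disappears.\<close>
    have "c' ` verts G \<subseteq> (*) 2 ` c ` verts G \<union> (\<lambda>v. Suc (2 * e v)) ` Y"
      by (auto simp: c'_def)
    then have "card (c' ` verts G) \<le> card ((*) 2 ` c ` verts G \<union> (\<lambda>v. Suc (2 * e v)) ` Y)"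
      using fin finite_verts by (intro card_mono) auto
    also have "\<dots> \<le> card ((*) 2 ` c ` verts G) + card ((\<lambda>v. Suc (2 * e v)) ` Y)"
      by (rule card_Un_le)
    also have "\<dots> \<le> card (c ` verts G) + card Y"
      using fin finite_verts by (intro add_mono card_image_le) auto
    finally show ?thesis .
  qed
  ultimately show ?thesis
    using that unique by blast
qed

theorem theorem2:
  fixes G :: "('a, 'b) pre_digraph" and X Y :: "'a set"
  assumes "graph G"
    and "Digraph_Component.connected G"
    and "twin_cover G X"
    and "Y \<subseteq> X"
    and "\<And>u v p. shortest_vpath G u p v \<Longrightarrow> vwalk_length p \<ge> 3 \<Longrightarrow> set p \<inter> Y \<noteq> {}"
  shows "svcfc G \<le> chromatic_number G + card Y"
proof -
  interpret graph G by fact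
  have "Y \<subseteq> verts G"
    using assms(3,4) by (auto simp: twin_cover_def)
  then obtain c where c: "proper_coloring G c"
    and card: "card (c ` verts G) \<le> chromatic_number G + card Y"
    and unique: "\<And>x y. y \<in> Y \<Longrightarrow> c x = c y \<Longrightarrow> x = y"
    by (metis chromatic_number_attained fresh_recoloring)
  have "strong_cfvc_coloring G c"
    unfolding strong_cfvc_coloring_def
  proof (intro ballI impI)
    fix u v assume uv: "u \<in> verts G" "v \<in> verts G" "u \<noteq> v"
    \<comment> \<open>Any shortest path will do, since each of them turns out to be conflict-free
      under \<open>c\<close>.\<close>
    obtain p where p: "shortest_vpath G u p v"
      using ex_shortest_vpath[OF assms(2) uv(1,2)] by blast
    have "conflict_free c p"
    proof (cases "vwalk_length p < 3")
      case True
      then show ?thesis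
        using p uv(3) by (intro conflict_free_short_vwalk[OF c])
          (auto simp: shortest_vpath_def vpath_def)
    next
      case False
      then obtain y where "y \<in> set p" "y \<in> Y"
        using assms(5)[OF p] by auto
      then show ?thesis
        using unique by (intro conflict_freeI[of y])
    qed
    with p show "\<exists>p. shortest_vpath G u p v \<and> conflict_free c p"
      by blast
  qed
  then have "svcfc G \<le> card (c ` verts G)"
    unfolding svcfc_def by (intro Least_le) blast
  with card show ?thesis
    by linarith
qed

end
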